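(* Let $M\ge 2$, let $\tau_1,\dots,\tau_k$ be the $k$ highest-priority tasks of an arbitrary-deadline sporadic task set scheduled by global fixed-priority preemptive scheduling on $M$ identical processors, and suppose that all jobs of $\tau_1,\dots,\tau_{k-1}$ always meet their deadlines. Task $\tau_k$ is schedulable if $$\delta_k+\sum_{i=1}^{k-1}\left(\frac{C_i-C_iU_i}{D_k}+U_i\right)\le M-(M-1)U_{\delta,k}^{\max}.$$
   Context: Model. There are $M\ge2$ identical unit-speed processors. A sporadic task $\tau_i$ has worst-case execution time $C_i>0$, minimum inter-arrival time $T_i>0$, relative deadline $D_i>0$ and utilization $U_i=C_i/T_i$; it is assumed that $C_i\le D_i$ and $U_i\le1$, with no relation required between $D_i$ and $T_i$ (arbitrary deadlines). Task $\tau_i$ releases an infinite sequence of jobs whose consecutive arrivals are at least $T_i$ apart; each job needs at most $C_i$ units of execution, and a job arriving at $t$ must finish by its absolute deadline $t+D_i$. Preemption and migration cost nothing. At any instant at most one job of each task executes, on at most one processor; jobs of the same task are executed in arrival order. Global fixed-priority preemptive scheduling: tasks have unique fixed priorities, $\tau_i$ having higher priority than $\tau_j$ iff $i<j$; at each instant, among the tasks having an arrived and unfinished job, the $M$ highest-priority ones (all of them if fewer than $M$) execute. A task is schedulable if in every schedule so produced, for every legal arrival sequence, all its jobs meet their deadlines. Notation. Density $\delta_i=C_i/\min\{D_i,T_i\}$; $U_{\delta,k}^{\max}=\max\{\max_{1\le i\le k-1}U_i,\ \delta_k\}$. *)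

theory Defs
  imports "HOL-Analysis.Analysis"
begin

record task =
  wcet :: real
  min_sep :: real
  rel_deadline :: real

definition utilization :: "task \<Rightarrow> real" where
  "utilization \<tau> = wcet \<tau> / min_sep \<tau>"

definition task_density :: "task \<Rightarrow> real" where
  "task_density \<tau> = wcet \<tau> / min (rel_deadline \<tau>) (min_sep \<tau>)"

definition sporadic_task :: "task \<Rightarrow> bool" where
  "sporadic_task \<tau> \<longleftrightarrow>
     0 < wcet \<tau> \<and> 0 < min_sep \<tau> \<and> 0 < rel_deadline \<tau> \<and>
     wcet \<tau> \<le> rel_deadline \<tau> \<and> utilization \<tau> \<le> 1"

text \<open>
  A task set is given by tasks \<open>ts 1, \<dots>, ts n\<close>, where a smaller index means a higher priority.
  The jobs of task \<open>i\<close> are numbered by \<open>j = 0, 1, 2, \<dots>\<close>; job \<open>j\<close> arrives at time \<open>a i j\<close> (any real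
  number, there is no distinguished time origin) and its actual execution demand is \<open>c i j\<close>.
\<close>

definition legal_jobs ::
  "nat \<Rightarrow> (nat \<Rightarrow> task) \<Rightarrow> (nat \<Rightarrow> nat \<Rightarrow> real) \<Rightarrow> (nat \<Rightarrow> nat \<Rightarrow> real) \<Rightarrow> bool" where
  "legal_jobs n ts a c \<longleftrightarrow>
     (\<forall>i\<in>{1..n}. \<forall>j. a i j + min_sep (ts i) \<le> a i (Suc j) \<and> 0 \<le> c i j \<and> c i j \<le> wcet (ts i))"

text \<open>
  \<open>\<sigma> p t = Some (i, j)\<close> means that processor \<open>p < M\<close> executes job \<open>j\<close> of task \<open>i\<close> at time \<open>t\<close>;
  \<open>None\<close> means that the processor is idle.
\<close>

type_synonym schedule = "nat \<Rightarrow> real \<Rightarrow> (nat \<times> nat) option"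

definition executes :: "nat \<Rightarrow> schedule \<Rightarrow> nat \<Rightarrow> nat \<Rightarrow> real \<Rightarrow> bool" where
  "executes M \<sigma> i j t \<longleftrightarrow> (\<exists>p<M. \<sigma> p t = Some (i, j))"

text \<open>The execution a job has received before time \<open>t\<close>, at unit speed.\<close>

definition service ::
  "nat \<Rightarrow> (nat \<Rightarrow> nat \<Rightarrow> real) \<Rightarrow> schedule \<Rightarrow> nat \<Rightarrow> nat \<Rightarrow> real \<Rightarrow> real" where
  "service M a \<sigma> i j t = measure lborel {s \<in> {a i j..<t}. executes M \<sigma> i j s}"

definition pending ::
  "nat \<Rightarrow> (nat \<Rightarrow> nat \<Rightarrow> real) \<Rightarrow> (nat \<Rightarrow> nat \<Rightarrow> real) \<Rightarrow> schedule \<Rightarrow> nat \<Rightarrow> nat \<Rightarrow> real \<Rightarrow> bool" where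
  "pending M a c \<sigma> i j t \<longleftrightarrow> a i j \<le> t \<and> service M a \<sigma> i j t < c i j"

definition active_tasks ::
  "nat \<Rightarrow> nat \<Rightarrow> (nat \<Rightarrow> nat \<Rightarrow> real) \<Rightarrow> (nat \<Rightarrow> nat \<Rightarrow> real) \<Rightarrow> schedule \<Rightarrow> real \<Rightarrow> nat set" where
  "active_tasks M n a c \<sigma> t = {i \<in> {1..n}. \<exists>j. pending M a c \<sigma> i j t}"

text \<open>
  Global fixed-priority preemptive schedules of the jobs \<open>a, c\<close> on \<open>M\<close> processors. The conjuncts say:
  execution times are Borel sets, so that \<^const>\<open>service\<close> is meaningful; a task never occupies two
  processors at once; only pending jobs run, and those of one task in arrival order; and
  the executing tasks are exactly the active ones with fewer than \<open>M\<close> active tasks of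
  higher priority.
\<close>

definition gfp_schedule ::
  "nat \<Rightarrow> nat \<Rightarrow> (nat \<Rightarrow> nat \<Rightarrow> real) \<Rightarrow> (nat \<Rightarrow> nat \<Rightarrow> real) \<Rightarrow> schedule \<Rightarrow> bool" where
  "gfp_schedule M n a c \<sigma> \<longleftrightarrow>
     (\<forall>p<M. \<forall>i j. {t. \<sigma> p t = Some (i, j)} \<in> sets borel) \<and>
     (\<forall>t i j j'. \<forall>p<M. \<forall>q<M. \<sigma> p t = Some (i, j) \<longrightarrow> \<sigma> q t = Some (i, j') \<longrightarrow> p = q) \<and>
     (\<forall>t i j. executes M \<sigma> i j t \<longrightarrow>
        pending M a c \<sigma> i j t \<and> (\<forall>j'<j. \<not> pending M a c \<sigma> i j' t)) \<and>
     (\<forall>t. {i. \<exists>j. executes M \<sigma> i j t} =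
        {i \<in> active_tasks M n a c \<sigma> t. card {h \<in> active_tasks M n a c \<sigma> t. h < i} < M})"

definition schedulable :: "nat \<Rightarrow> nat \<Rightarrow> (nat \<Rightarrow> task) \<Rightarrow> nat \<Rightarrow> bool" where
  "schedulable M n ts i \<longleftrightarrow>
     (\<forall>a c \<sigma>. legal_jobs n ts a c \<longrightarrow> gfp_schedule M n a c \<sigma> \<longrightarrow>
        (\<forall>j. c i j \<le> service M a \<sigma> i j (a i j + rel_deadline (ts i))))"

text \<open>For \<open>k = 1\<close> there are no higher-priority tasks and the value is the density of \<open>ts 1\<close>.\<close>

definition U_delta_max :: "(nat \<Rightarrow> task) \<Rightarrow> nat \<Rightarrow> real" where
  "U_delta_max ts k = Max (insert (task_density (ts k)) ((\<lambda>i. utilization (ts i)) ` {1..<k}))"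

end

theory Submission
  imports Defs
begin

text \<open>
  Suppose that a job of task \<open>k\<close> misses its deadline at \<open>d\<close>. Let \<open>s\<close> be the arrival from which
  task \<open>k\<close> is continuously active until \<open>d\<close>; in \<open>[s, d)\<close> it executes for less than \<open>\<delta>\<^sub>k (d - s)\<close>
  and whenever it does not execute, \<open>M\<close> tasks of higher priority do. Hence the work \<open>W(t, d)\<close> of
  these tasks in \<open>[t, d)\<close> exceeds \<open>\<rho> (d - t)\<close> at \<open>t = s\<close>, where
  \<open>\<rho> = M - (M - 1) U\<^sub>m\<^sub>a\<^sub>x - \<delta>\<^sub>k\<close>. Push the left end of the window back to the point \<open>r \<le> s\<close> that
  maximizes \<open>W(t, d) - \<rho> (d - t)\<close>. By maximality \<open>W(t, r) \<le> \<rho> (r - t)\<close> for earlier \<open>t\<close>, so a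
  higher-priority task \<open>i\<close> that has been active since \<open>t\<close> has executed for at least \<open>U\<^sub>i (r - t)\<close>
  in \<open>[t, r)\<close>. Its carry-in is thus compensated, and it contributes at most
  \<open>U\<^sub>i (d - r) + C\<^sub>i - C\<^sub>i U\<^sub>i\<close> to \<open>W(r, d)\<close>. Summation over \<open>i\<close> contradicts the hypothesis.
\<close>

section \<open>Occupied time within half-open windows, and a counting fact\<close>

definition occupancy :: "real set \<Rightarrow> real \<Rightarrow> real \<Rightarrow> real" where
  "occupancy B x y = measure lborel (B \<inter> {x..<y})"

lemma fmeasurable_Int_interval:
  fixes B :: "real set"
  assumes "B \<in> sets borel"
  shows "B \<inter> {x..<y} \<in> fmeasurable lborel"
proof (rule fmeasurableI2)
  show "{x..<y} \<in> fmeasurable lborel"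
    by (cases "x \<le> y") (auto simp: fmeasurable_def)
qed (use assms in auto)

lemma occupancy_nonneg: "0 \<le> occupancy B x y"
  by (simp add: occupancy_def)

lemma occupancy_le_length:
  assumes "B \<in> sets borel" "x \<le> y"
  shows "occupancy B x y \<le> y - x"
proof -
  have "occupancy B x y \<le> measure lborel {x..<y}"
    unfolding occupancy_def
    using assms fmeasurable_Int_interval[of UNIV x y] by (intro measure_mono_fmeasurable) auto
  then show ?thesis using assms(2) by simp
qed

lemma occupancy_split:
  assumes "B \<in> sets borel" "x \<le> y" "y \<le> z"
  shows "occupancy B x z = occupancy B x y + occupancy B y z"
proof -
  have "B \<inter> {x..<z} = (B \<inter> {x..<y}) \<union> (B \<inter> {y..<z})" using assms(2,3) by auto
  moreover have "(B \<inter> {x..<y}) \<inter> (B \<inter> {y..<z}) = {}" by auto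
  ultimately show ?thesis
    using measure_Un3[OF fmeasurable_Int_interval[OF assms(1), of x y] fmeasurable_Int_interval[OF assms(1), of y z]]
    by (simp add: occupancy_def)
qed

lemma occupancy_mono_right:
  assumes "B \<in> sets borel" "y \<le> z"
  shows "occupancy B x y \<le> occupancy B x z"
  unfolding occupancy_def
  using assms by (intro measure_mono_fmeasurable fmeasurable_Int_interval) auto

text \<open>Moving an endpoint from \<open>u\<close> to \<open>v\<close> changes the occupied time
  by at most the distance, so the function is 1-Lipschitz. Continuity in the right end is needed to
  stop a job exactly at its demand, continuity in the left end (next lemma) to find a maximizing
  window.\<close>

lemma continuous_on_occupancy_right:
  assumes "B \<in> sets borel"
  shows "continuous_on {x..} (occupancy B x)"
proof -
  have *: "dist (occupancy B x u) (occupancy B x v) \<le> 1 * dist u v" if "x \<le> u" "u \<le> v" for u v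
    using occupancy_split[OF assms that] occupancy_le_length[OF assms that(2)]
      occupancy_nonneg[of B u v] that by (simp add: dist_real_def)
  have "1-lipschitz_on {x..} (occupancy B x)"
  proof (rule lipschitz_onI)
    fix u v assume "u \<in> {x..}" "v \<in> {x..}"
    then show "dist (occupancy B x u) (occupancy B x v) \<le> 1 * dist u v"
      using *[of u v] *[of v u] by (cases "u \<le> v") (auto simp: dist_commute)
  qed simp
  then show ?thesis by (rule lipschitz_on_continuous_on)
qed

lemma continuous_on_occupancy_left:
  assumes "B \<in> sets borel"
  shows "continuous_on {..y} (\<lambda>x. occupancy B x y)"
proof -
  have *: "dist (occupancy B u y) (occupancy B v y) \<le> 1 * dist u v" if "u \<le> v" "v \<le> y" for u v
    using occupancy_split[OF assms that] occupancy_le_length[OF assms that(1)]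
      occupancy_nonneg[of B u v] that by (simp add: dist_real_def)
  have "1-lipschitz_on {..y} (\<lambda>x. occupancy B x y)"
  proof (rule lipschitz_onI)
    fix u v assume "u \<in> {..y}" "v \<in> {..y}"
    then show "dist (occupancy B u y) (occupancy B v y) \<le> 1 * dist u v"
      using *[of u v] *[of v u] by (cases "u \<le> v") (auto simp: dist_commute)
  qed simp
  then show ?thesis by (rule lipschitz_on_continuous_on)
qed

lemma occupancy_cover:
  assumes "finite I" "\<And>i. i \<in> I \<Longrightarrow> A i \<in> sets borel" "B \<in> sets borel"
    and "\<And>t. \<lbrakk>t \<in> B; x \<le> t; t < y\<rbrakk> \<Longrightarrow> \<exists>i\<in>I. t \<in> A i"
  shows "occupancy B x y \<le> (\<Sum>i\<in>I. occupancy (A i) x y)"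
proof -
  have "occupancy B x y \<le> measure lborel (\<Union>i\<in>I. A i \<inter> {x..<y})"
    unfolding occupancy_def
    using assms by (intro measure_mono_fmeasurable fmeasurable.finite_UN fmeasurable_Int_interval) auto
  also have "\<dots> \<le> (\<Sum>i\<in>I. occupancy (A i) x y)"
    unfolding occupancy_def
    using assms by (intro measure_UNION_le) auto
  finally show ?thesis .
qed

lemma occupancy_integral:
  assumes "B \<in> sets borel"
  shows "occupancy B x y = (LINT t|lborel. indicator (B \<inter> {x..<y}) t)"
    and "integrable lborel (indicator (B \<inter> {x..<y}) :: real \<Rightarrow> real)"
  using fmeasurable_Int_interval[OF assms, of x y]
  by (auto simp: occupancy_def fmeasurable_def)

text \<open>This integrates a pointwise bound: at each instant of the window outside
  \<open>B\<close>, at least \<open>m\<close> of the indicators of the sets \<open>A h\<close> equal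
  1.\<close>

lemma occupancy_count_ge:
  assumes "finite H" "\<And>h. h \<in> H \<Longrightarrow> A h \<in> sets borel" "B \<in> sets borel" "x \<le> y"
    and "\<And>t. \<lbrakk>x \<le> t; t < y; t \<notin> B\<rbrakk> \<Longrightarrow> m \<le> card {h\<in>H. t \<in> A h}"
  shows "real m * (y - x - occupancy B x y) \<le> (\<Sum>h\<in>H. occupancy (A h) x y)"
proof -
  let ?ind = "indicator :: real set \<Rightarrow> real \<Rightarrow> real"
  note int = occupancy_integral(2)
  have "real m * (y - x - occupancy B x y) =
      (LINT t|lborel. real m * (?ind (UNIV \<inter> {x..<y}) t - ?ind (B \<inter> {x..<y}) t))"
    using assms(4) occupancy_integral[OF assms(3), of x y] occupancy_integral[of UNIV x y]
    by (subst integral_mult_right_zero, subst Bochner_Integration.integral_diff)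
      (auto simp: occupancy_def)
  also have "\<dots> \<le> (LINT t|lborel. (\<Sum>h\<in>H. ?ind (A h \<inter> {x..<y}) t))"
  proof (rule integral_mono)
    show "integrable lborel (\<lambda>t. real m * (?ind (UNIV \<inter> {x..<y}) t - ?ind (B \<inter> {x..<y}) t))"
      using int[of UNIV x y] int[OF assms(3), of x y] by (auto simp del: Int_UNIV_left)
    show "integrable lborel (\<lambda>t. \<Sum>h\<in>H. ?ind (A h \<inter> {x..<y}) t)"
      using int[OF assms(2), of _ x y] by auto
  next
    fix t :: real
    show "real m * (?ind (UNIV \<inter> {x..<y}) t - ?ind (B \<inter> {x..<y}) t) \<le> (\<Sum>h\<in>H. ?ind (A h \<inter> {x..<y}) t)"
    proof (cases "x \<le> t \<and> t < y \<and> t \<notin> B")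
      case True
      have "(\<Sum>h\<in>H. ?ind (A h \<inter> {x..<y}) t) = real (card {h\<in>H. t \<in> A h})"
        using True assms(1) by (simp add: indicator_def sum.If_cases Int_def)
      then show ?thesis using True assms(5)[of t] by simp
    next
      case False
      then have "?ind (UNIV \<inter> {x..<y}) t - ?ind (B \<inter> {x..<y}) t = 0"
        by (auto simp: indicator_def)
      then show ?thesis by (simp add: sum_nonneg)
    qed
  qed
  also have "\<dots> = (\<Sum>h\<in>H. occupancy (A h) x y)"
    using occupancy_integral[OF assms(2), of _ x y]
    by (subst Bochner_Integration.integral_sum) auto
  finally show ?thesis .
qed

text \<open>The \<open>m\<close> least elements of \<open>A\<close> each have fewer than
  \<open>m\<close> predecessors in \<open>A\<close>, and they lie below \<open>i\<close> once
  \<open>m\<close> elements do. With \<open>m = M\<close> this turns \<open>M\<close> active tasks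
  of higher priority into \<open>M\<close> executing ones.\<close>

lemma card_lowest_ge:
  fixes A :: "nat set"
  assumes "finite A" "m \<le> card {h\<in>A. h < i}"
  shows "m \<le> card {h\<in>A. h < i \<and> card {g\<in>A. g < h} < m}"
  using assms(2)
proof (induction m)
  case (Suc m)
  define S where "S = {h\<in>A. h < i \<and> card {g\<in>A. g < h} < m}"
  have fin: "finite S" unfolding S_def using assms(1) by auto
  have sub: "S \<subseteq> {h\<in>A. h < i \<and> card {g\<in>A. g < h} < Suc m}" unfolding S_def by auto
  have "m \<le> card S" using Suc unfolding S_def by simp
  show ?case
  proof (cases "m < card S")
    case True
    with card_mono[OF _ sub] assms(1) show ?thesis by simp
  next
    case False
    with \<open>m \<le> card S\<close> have cS: "card S = m" by simp
    let ?R = "{h\<in>A. h < i} - S"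
    have "S \<noteq> {h\<in>A. h < i}" using cS Suc.prems by auto
    then have ne: "?R \<noteq> {}" and finR: "finite ?R" using assms(1) unfolding S_def by auto
    \<comment> \<open>All predecessors of this element in \<open>A\<close> already belong to
      \<open>S\<close>, so it has at most \<open>m\<close> of them and may be added to
      \<open>S\<close>.\<close>
    define x where "x = Min ?R"
    have x: "x \<in> ?R" unfolding x_def by (rule Min_in[OF finR ne])
    have "{g\<in>A. g < x} \<subseteq> S"
    proof
      fix g assume g: "g \<in> {g\<in>A. g < x}"
      show "g \<in> S"
      proof (rule ccontr)
        assume "g \<notin> S"
        then have "g \<in> ?R" using g x by auto
        then have "x \<le> g" unfolding x_def using finR by simp
        then show False using g by simp
      qed
    qed
    then have "card {g\<in>A. g < x} \<le> m" using card_mono[OF fin] cS by metis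
    then have "insert x S \<subseteq> {h\<in>A. h < i \<and> card {g\<in>A. g < h} < Suc m}"
      using x sub by auto
    then have "card (insert x S) \<le> card {h\<in>A. h < i \<and> card {g\<in>A. g < h} < Suc m}"
      using assms(1) by (intro card_mono) auto
    then show ?thesis using x cS fin by simp
  qed
qed simp

section \<open>Service, pending jobs, busy intervals and blocking in a fixed schedule\<close>

locale gfp_run =
  fixes M n :: nat and ts :: "nat \<Rightarrow> task" and a c :: "nat \<Rightarrow> nat \<Rightarrow> real" and \<sigma> :: schedule
  assumes tasks: "\<And>i. i \<in> {1..n} \<Longrightarrow> sporadic_task (ts i)"
    and legal: "legal_jobs n ts a c"
    and gfp: "gfp_schedule M n a c \<sigma>"
begin

abbreviation "C i \<equiv> wcet (ts i)"
abbreviation "T i \<equiv> min_sep (ts i)"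
abbreviation "U i \<equiv> utilization (ts i)"

definition runs :: "nat \<Rightarrow> real set" where
  "runs i = {t. \<exists>j. executes M \<sigma> i j t}"

definition active :: "nat \<Rightarrow> real \<Rightarrow> bool" where
  "active i t \<longleftrightarrow> (\<exists>j. pending M a c \<sigma> i j t)"

lemma executes_borel: "{t. executes M \<sigma> i j t} \<in> sets borel"
proof -
  have "{t. executes M \<sigma> i j t} = (\<Union>p<M. {t. \<sigma> p t = Some (i, j)})"
    by (auto simp: executes_def)
  then show ?thesis using gfp by (auto simp: gfp_schedule_def)
qed

lemma runs_borel: "runs i \<in> sets borel"
proof -
  have "runs i = (\<Union>j. {t. executes M \<sigma> i j t})" by (auto simp: runs_def)
  then show ?thesis using executes_borel by auto
qed

lemma service_eq: "service M a \<sigma> i j t = occupancy {t. executes M \<sigma> i j t} (a i j) t"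
  unfolding service_def occupancy_def by (rule arg_cong[of _ _ "measure lborel"]) auto

lemma executes_pending: "executes M \<sigma> i j t \<Longrightarrow> pending M a c \<sigma> i j t"
  using gfp by (auto simp: gfp_schedule_def)

lemma executes_first: "\<lbrakk>executes M \<sigma> i j t; pending M a c \<sigma> i j' t\<rbrakk> \<Longrightarrow> j \<le> j'"
  using gfp unfolding gfp_schedule_def by (meson not_less)

lemma pending_antimono:
  assumes "pending M a c \<sigma> i j t" "a i j \<le> u" "u \<le> t"
  shows "pending M a c \<sigma> i j u"
  using assms occupancy_mono_right[OF executes_borel assms(3), of i j "a i j"]
  unfolding pending_def service_eq by auto

lemma demand_bounds:
  assumes "i \<in> {1..n}"
  shows "0 \<le> c i j" "c i j \<le> C i"
  using legal assms by (auto simp: legal_jobs_def)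

lemma task_bounds:
  assumes "i \<in> {1..n}"
  shows "0 < C i" "0 < T i" "0 < U i" "U i \<le> 1" "U i * T i = C i"
  using tasks[OF assms] by (auto simp: sporadic_task_def utilization_def)

lemma arrival_spacing:
  assumes "i \<in> {1..n}"
  shows "a i j + real m * T i \<le> a i (j + m)"
proof (induction m)
  case (Suc m)
  have "a i (j + m) + T i \<le> a i (Suc (j + m))"
    using legal assms by (auto simp: legal_jobs_def)
  with Suc show ?case by (simp add: algebra_simps)
qed simp

lemma arrival_mono:
  assumes "i \<in> {1..n}" "j \<le> j'"
  shows "a i j \<le> a i j'"
proof -
  have "0 \<le> real (j' - j) * T i" using task_bounds(2)[OF assms(1)] by simp
  then show ?thesis using arrival_spacing[OF assms(1), of j "j' - j"] assms(2) by simp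
qed

text \<open>Only pending jobs execute, so a job stops for good once its service equals its demand;
  continuity of the service in time excludes a jump past that value.\<close>

lemma service_le_demand:
  assumes "i \<in> {1..n}"
  shows "service M a \<sigma> i j t \<le> c i j"
proof (rule ccontr)
  let ?B = "{t. executes M \<sigma> i j t}"
  assume "\<not> service M a \<sigma> i j t \<le> c i j"
  then have gt: "c i j < occupancy ?B (a i j) t" by (simp add: service_eq)
  have 0: "occupancy ?B (a i j) (a i j) \<le> c i j"
    using demand_bounds(1)[OF assms] by (simp add: occupancy_def)
  have at: "a i j \<le> t"
  proof (rule ccontr)
    assume "\<not> a i j \<le> t"
    then have "occupancy ?B (a i j) t = 0" by (simp add: occupancy_def)
    then show False using gt demand_bounds(1)[OF assms, of j] by simp
  qed
  have "continuous_on {a i j..t} (occupancy ?B (a i j))"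
    by (rule continuous_on_subset[OF continuous_on_occupancy_right[OF executes_borel]]) auto
  with IVT'[of "occupancy ?B (a i j)" "a i j" "c i j" t] 0 gt at obtain u where u: "a i j \<le> u" "u \<le> t" "occupancy ?B (a i j) u = c i j"
    by auto
  have "?B \<inter> {u..<t} = {}"
  proof (rule equals0I)
    fix v assume v: "v \<in> ?B \<inter> {u..<t}"
    then have "occupancy ?B (a i j) v < c i j"
      using executes_pending[of i j v] by (auto simp: pending_def service_eq)
    moreover have "occupancy ?B (a i j) u \<le> occupancy ?B (a i j) v"
      using v by (intro occupancy_mono_right executes_borel) auto
    ultimately show False using u(3) by simp
  qed
  then have "occupancy ?B u t = 0" unfolding occupancy_def by simp
  with occupancy_split[OF executes_borel u(1,2)] u(3) gt show False by simp
qed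

text \<open>The start is sought among arrivals, so the well-ordering of job indices provides it and
  no infimum over time is taken. If an earlier job were pending at \<open>a i j\<close>, the task
  would have been active ever since that job's arrival, contradicting minimality.\<close>

lemma busy_start:
  assumes "active i t" "i \<in> {1..n}"
  obtains j where "a i j \<le> t" "\<And>u. \<lbrakk>a i j \<le> u; u \<le> t\<rbrakk> \<Longrightarrow> active i u"
    "\<And>j'. j' < j \<Longrightarrow> \<not> pending M a c \<sigma> i j' (a i j)"
    "\<And>j'. pending M a c \<sigma> i j' t \<Longrightarrow> j \<le> j'"
proof -
  define P where "P j \<longleftrightarrow> a i j \<le> t \<and> (\<forall>u. a i j \<le> u \<longrightarrow> u \<le> t \<longrightarrow> active i u)" for j
  have P: "P j" if "pending M a c \<sigma> i j t" for j
    using that pending_antimono[OF that] by (auto simp: P_def active_def pending_def)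
  obtain j0 where "P j0" using assms(1) P by (auto simp: active_def)
  define j where "j = (LEAST j. P j)"
  have j: "P j" unfolding j_def using \<open>P j0\<close> by (rule LeastI)
  have least: "j \<le> j'" if "P j'" for j' unfolding j_def using that by (rule Least_le)
  have "\<not> pending M a c \<sigma> i j' (a i j)" if "j' < j" for j'
  proof
    assume pend: "pending M a c \<sigma> i j' (a i j)"
    have "active i u" if "a i j' \<le> u" "u \<le> t" for u
    proof (cases "u \<le> a i j")
      case True
      then show ?thesis using pending_antimono[OF pend that(1)] by (auto simp: active_def)
    next
      case False
      then show ?thesis using j that by (auto simp: P_def)
    qed
    then have "P j'" using j pend by (auto simp: P_def pending_def)
    then show False using least[of j'] that by simp
  qed
  then show thesis using that[of j] j least P by (auto simp: P_def)
qed

text \<open>A waiting task has at least \<open>M\<close> active tasks above it, and among these the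
  \<open>M\<close> of highest priority meet the criterion for executing.\<close>

lemma active_runs_or_blocked:
  assumes "active i t" "i \<in> {1..n}" "t \<notin> runs i"
  shows "M \<le> card {h\<in>{1..<i}. t \<in> runs h}"
proof -
  let ?A = "active_tasks M n a c \<sigma> t"
  have eq: "{i. \<exists>j. executes M \<sigma> i j t} = {i \<in> ?A. card {h \<in> ?A. h < i} < M}"
    using gfp unfolding gfp_schedule_def by blast
  have "i \<in> ?A" using assms by (auto simp: active_tasks_def active_def)
  then have "M \<le> card {h\<in>?A. h < i}" using eq assms(3) by (auto simp: runs_def)
  then have "M \<le> card {h\<in>?A. h < i \<and> card {g\<in>?A. g < h} < M}"
    by (intro card_lowest_ge) (auto simp: active_tasks_def)
  also have "\<dots> \<le> card {h\<in>{1..<i}. t \<in> runs h}"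
  proof (rule card_mono)
    show "{h\<in>?A. h < i \<and> card {g\<in>?A. g < h} < M} \<subseteq> {h\<in>{1..<i}. t \<in> runs h}"
      using eq by (auto simp: runs_def active_tasks_def)
  qed simp
  finally show ?thesis .
qed

lemma blocking_work:
  assumes "i \<in> {1..n}" "x \<le> y" "\<And>u. \<lbrakk>x \<le> u; u \<le> y\<rbrakk> \<Longrightarrow> active i u"
  shows "real M * (y - x - occupancy (runs i) x y) \<le> (\<Sum>h\<in>{1..<i}. occupancy (runs h) x y)"
  using assms by (intro occupancy_count_ge runs_borel active_runs_or_blocked) auto

section \<open>Bounds on the work of a single task in a window\<close>

lemma occupancy_executes_le_service:
  assumes "x \<le> a i j"
  shows "occupancy {t. executes M \<sigma> i j t} x t \<le> service M a \<sigma> i j t"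
  unfolding service_eq occupancy_def
proof (intro measure_mono_fmeasurable fmeasurable_Int_interval executes_borel)
  show "{t. executes M \<sigma> i j t} \<inter> {x..<t} \<subseteq> {t. executes M \<sigma> i j t} \<inter> {a i j..<t}"
    using executes_pending by (auto simp: pending_def)
qed (use executes_borel in auto)

lemma not_executes_after_completion:
  assumes "\<not> pending M a c \<sigma> i j s" "a i j \<le> s" "s \<le> t"
  shows "\<not> executes M \<sigma> i j t"
  using assms pending_antimono executes_pending by blast

text \<open>Without unfinished work from before \<open>s\<close>, only jobs arriving in the window
  execute. All but the last are paid for at rate \<open>U i\<close> by the separations between
  arrivals; the constant \<open>C i - C i * U i\<close> covers the last job, which may run at full
  speed up to \<open>t\<close>.\<close>

lemma window_work_le:
  assumes i: "i \<in> {1..n}" and "s \<le> t"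
    and clean: "\<And>j. a i j < s \<Longrightarrow> \<not> pending M a c \<sigma> i j s"
  shows "occupancy (runs i) s t \<le> U i * (t - s) + (C i - C i * U i)"
proof -
  note tb = task_bounds[OF i]
  define J where "J = {j. s \<le> a i j \<and> a i j < t}"
  \<comment> \<open>Arrivals grow at least linearly with the job index, so only finitely many
    precede \<open>t\<close>.\<close>
  have "finite J"
  proof -
    obtain m :: nat where m: "(t - a i 0) / T i < real m" using reals_Archimedean2 by blast
    then have "t < a i 0 + real m * T i" using tb(2) by (simp add: field_simps)
    then have "t < a i m" using arrival_spacing[OF i, of 0 m] by simp
    then have "j < m" if "j \<in> J" for j
      using that arrival_mono[OF i, of m j] by (cases "m \<le> j") (auto simp: J_def)
    then have "J \<subseteq> {..<m}" by auto
    then show ?thesis by (rule finite_subset) simp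
  qed
  have arrived: "\<exists>j\<in>J. u \<in> {t. executes M \<sigma> i j t}" if "u \<in> runs i" "s \<le> u" "u < t" for u
  proof -
    obtain j where j: "executes M \<sigma> i j u" using \<open>u \<in> runs i\<close> by (auto simp: runs_def)
    then have "a i j \<le> u" using executes_pending by (auto simp: pending_def)
    moreover have "s \<le> a i j"
      using j clean[of j] not_executes_after_completion[of i j s u] \<open>s \<le> u\<close> by force
    ultimately show ?thesis using j \<open>u < t\<close> by (auto simp: J_def)
  qed
  have "occupancy (runs i) s t \<le> (\<Sum>j\<in>J. occupancy {t. executes M \<sigma> i j t} s t)"
    by (rule occupancy_cover[OF \<open>finite J\<close> executes_borel runs_borel arrived])
  also have "\<dots> \<le> (\<Sum>j\<in>J. service M a \<sigma> i j t)"
    by (intro sum_mono occupancy_executes_le_service) (auto simp: J_def)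
  finally have work: "occupancy (runs i) s t \<le> (\<Sum>j\<in>J. service M a \<sigma> i j t)" .
  have CU: "0 \<le> C i - C i * U i" using tb by (simp add: mult_left_le)
  show ?thesis
  proof (cases "J = {}")
    case True
    have "0 \<le> U i * (t - s)" using tb \<open>s \<le> t\<close> by simp
    then show ?thesis using work True CU by simp
  next
    case False
    define p N where "p = Min J" and "N = Max J"
    have pN: "p \<in> J" "N \<in> J" "p \<le> N" "J \<subseteq> {p..N}"
      using False \<open>finite J\<close> by (auto simp: p_def N_def)
    have serv_C: "service M a \<sigma> i j t \<le> C i" for j
      using service_le_demand[OF i] demand_bounds[OF i] by (meson order_trans)
    have serv_N: "service M a \<sigma> i N t \<le> t - a i N"
      unfolding service_eq using pN(2) by (intro occupancy_le_length executes_borel) (auto simp: J_def)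
    have "(\<Sum>j\<in>J. service M a \<sigma> i j t) = service M a \<sigma> i N t + (\<Sum>j\<in>J - {N}. service M a \<sigma> i j t)"
      using \<open>finite J\<close> pN(2) by (rule sum.remove)
    also have "(\<Sum>j\<in>J - {N}. service M a \<sigma> i j t) \<le> real (card (J - {N})) * C i"
      by (rule sum_bounded_above) (rule serv_C)
    also have "\<dots> \<le> real (N - p) * C i"
    proof -
      have "card (J - {N}) \<le> card {p..<N}" using pN(4) by (intro card_mono) auto
      then show ?thesis using tb(1) by simp
    qed
    finally have w: "occupancy (runs i) s t \<le> service M a \<sigma> i N t + real (N - p) * C i"
      using work by simp
    define r where "r = t - a i N"
    \<comment> \<open>The service of the last job is at most the minimum of \<open>r\<close> and
      \<open>C i\<close>. The line of slope \<open>U i\<close> through the corner of this minimum at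
      \<open>r = C i\<close> lies above it because \<open>0 \<le> U i \<le> 1\<close>.\<close>
    have "service M a \<sigma> i N t \<le> U i * r + (C i - C i * U i)"
    proof (cases "C i \<le> r")
      case True
      then have "U i * C i \<le> U i * r" using tb by simp
      then show ?thesis using serv_C[of N] by (simp add: mult.commute)
    next
      case False
      then have "(1 - U i) * r \<le> (1 - U i) * C i" using tb by (intro mult_left_mono) auto
      then show ?thesis using serv_N by (simp add: r_def algebra_simps)
    qed
    \<comment> \<open>At least \<open>N - p\<close> separations fit between \<open>s\<close> and
      \<open>a i N\<close>, and each is worth \<open>U i * T i = C i\<close>, the amount charged to
      one job before \<open>N\<close>.\<close>
    moreover have "U i * r \<le> U i * (t - s) - real (N - p) * C i"
    proof -
      have "s + real (N - p) * T i \<le> a i N"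
        using arrival_spacing[OF i, of p "N - p"] pN(1,3) by (simp add: J_def)
      then have "r \<le> (t - s) - real (N - p) * T i" by (simp add: r_def)
      then have "U i * r \<le> U i * ((t - s) - real (N - p) * T i)" using tb by simp
      also have "\<dots> = U i * (t - s) - real (N - p) * (U i * T i)" by (simp add: algebra_simps)
      finally show ?thesis using tb(5) by simp
    qed
    ultimately show ?thesis using w by simp
  qed
qed

text \<open>Jobs before \<open>p\<close> are finished at the start, and jobs after \<open>j\<close>
  must wait for \<open>j\<close>, which is still pending at \<open>d\<close>. So only the
  \<open>Suc j - p\<close> jobs from \<open>p\<close> to \<open>j\<close> execute; strictness comes
  from job \<open>j\<close>, which is short of its own demand.\<close>

lemma late_task_work_lt:
  assumes i: "i \<in> {1..n}" and "p \<le> j" and pend: "pending M a c \<sigma> i j d"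
    and clean: "\<And>j'. j' < p \<Longrightarrow> \<not> pending M a c \<sigma> i j' (a i p)"
  shows "occupancy (runs i) (a i p) d < real (Suc j - p) * C i"
proof -
  have range: "\<exists>l\<in>{p..j}. u \<in> {t. executes M \<sigma> i l t}" if "u \<in> runs i" "a i p \<le> u" "u < d" for u
  proof -
    obtain l where l: "executes M \<sigma> i l u" using \<open>u \<in> runs i\<close> by (auto simp: runs_def)
    have "p \<le> l"
    proof (rule ccontr)
      assume "\<not> p \<le> l"
      then show False
        using not_executes_after_completion[OF clean, of l u] arrival_mono[OF i, of l p] l that by simp
    qed
    moreover have "l \<le> j"
    proof (rule ccontr)
      assume "\<not> l \<le> j"
      moreover have "a i l \<le> u" using executes_pending[OF l] by (simp add: pending_def)
      ultimately have "a i j \<le> u" using arrival_mono[OF i, of j l] by simp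
      then have "pending M a c \<sigma> i j u" using pending_antimono[OF pend] that by simp
      then show False using executes_first[OF l] \<open>\<not> l \<le> j\<close> by simp
    qed
    ultimately show ?thesis using l by auto
  qed
  have "occupancy (runs i) (a i p) d \<le> (\<Sum>l\<in>{p..j}. occupancy {t. executes M \<sigma> i l t} (a i p) d)"
    by (rule occupancy_cover[OF _ executes_borel runs_borel range]) auto
  also have "\<dots> \<le> (\<Sum>l\<in>{p..j}. service M a \<sigma> i l d)"
    using arrival_mono[OF i] by (intro sum_mono occupancy_executes_le_service) auto
  also have "\<dots> < (\<Sum>l\<in>{p..j}. C i)"
  proof (rule sum_strict_mono_ex1)
    show "\<exists>l\<in>{p..j}. service M a \<sigma> i l d < C i"
      using \<open>p \<le> j\<close> pend demand_bounds(2)[OF i, of j] by (auto simp: pending_def intro!: bexI[of _ j])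
    show "\<forall>l\<in>{p..j}. service M a \<sigma> i l d \<le> C i"
      using service_le_demand[OF i] demand_bounds(2)[OF i] by (meson order_trans)
  qed simp
  finally show ?thesis by simp
qed

section \<open>Interference from higher priorities and the extended window\<close>

definition work_above :: "nat \<Rightarrow> real \<Rightarrow> real \<Rightarrow> real" where
  "work_above k x y = (\<Sum>i\<in>{1..<k}. occupancy (runs i) x y)"

lemma work_above_split: "x \<le> y \<Longrightarrow> y \<le> z \<Longrightarrow> work_above k x z = work_above k x y + work_above k y z"
  unfolding work_above_def sum.distrib[symmetric]
  by (intro sum.cong refl occupancy_split runs_borel)

text \<open>If task \<open>i\<close> is active at \<open>r\<close>, the carry-in-free bound is
  applied from the start \<open>s\<close> of its busy interval, and the execution \<open>e\<close>
  already received in \<open>[s, r)\<close> is subtracted. Lightness of the load before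
  \<open>r\<close> forces \<open>e\<close> to be at least \<open>U i * (r - s)\<close>.\<close>

lemma compensated_work_le:
  assumes i: "i \<in> {1..<k}" and "k \<le> n" "2 \<le> M" "r \<le> d"
    and \<rho>: "\<rho> \<le> real M - (real M - 1) * U i"
    and light: "\<And>t. \<lbrakk>a i 0 \<le> t; t \<le> r\<rbrakk> \<Longrightarrow> work_above k t r \<le> \<rho> * (r - t)"
  shows "occupancy (runs i) r d \<le> U i * (d - r) + (C i - C i * U i)"
proof (cases "active i r")
  case False
  then show ?thesis using assms by (intro window_work_le) (auto simp: active_def)
next
  case True
  have in_n: "i \<in> {1..n}" using i \<open>k \<le> n\<close> by auto
  obtain p where p: "a i p \<le> r" "\<And>u. \<lbrakk>a i p \<le> u; u \<le> r\<rbrakk> \<Longrightarrow> active i u"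
    "\<And>j'. j' < p \<Longrightarrow> \<not> pending M a c \<sigma> i j' (a i p)"
    by (rule busy_start[OF True in_n]) blast
  define s e where "s = a i p" and "e = occupancy (runs i) s r"
  have "real M * (r - s - e) \<le> (\<Sum>h\<in>{1..<i}. occupancy (runs h) s r)"
    unfolding e_def s_def by (rule blocking_work[OF in_n p(1,2)])
  \<comment> \<open>Since \<open>i < k\<close>, the task's own execution also counts in
    \<open>work_above\<close>, on top of the work that blocks it.\<close>
  also have "\<dots> + e \<le> work_above k s r"
  proof -
    have "(\<Sum>h\<in>{1..<i}. occupancy (runs h) s r) + e = (\<Sum>h\<in>insert i {1..<i}. occupancy (runs h) s r)"
      by (simp add: e_def)
    also have "\<dots> \<le> work_above k s r"
      unfolding work_above_def using i by (intro sum_mono2) (auto simp: occupancy_nonneg)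
    finally show ?thesis .
  qed
  finally have "real M * (r - s - e) + e \<le> work_above k s r" by simp
  also have "\<dots> \<le> \<rho> * (r - s)"
    using light[of s] p(1) arrival_mono[OF in_n, of 0 p] by (simp add: s_def)
  also have "\<dots> \<le> (real M - (real M - 1) * U i) * (r - s)"
    using \<rho> p(1) by (intro mult_right_mono) (auto simp: s_def)
  \<comment> \<open>Both sides contain \<open>M * (r - s)\<close>; what remains carries the factor
    \<open>M - 1\<close>, which is positive.\<close>
  finally have "(real M - 1) * (U i * (r - s)) \<le> (real M - 1) * e"
    by (simp add: algebra_simps)
  then have "U i * (r - s) \<le> e" using \<open>2 \<le> M\<close> by (simp add: mult_le_cancel_left)
  moreover have "occupancy (runs i) s d \<le> U i * (d - s) + (C i - C i * U i)"
  proof (rule window_work_le[OF in_n])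
    show "s \<le> d" using p(1) \<open>r \<le> d\<close> by (simp add: s_def)
    show "\<not> pending M a c \<sigma> i j s" if "a i j < s" for j
    proof -
      have "j < p" using that arrival_mono[OF in_n, of p j] by (force simp: s_def)
      then show ?thesis using p(3) by (simp add: s_def)
    qed
  qed
  moreover have "occupancy (runs i) s d = e + occupancy (runs i) r d"
    unfolding e_def using p(1) \<open>r \<le> d\<close> by (intro occupancy_split runs_borel) (auto simp: s_def)
  ultimately show ?thesis by (simp add: algebra_simps)
qed

lemma no_deadline_miss:
  assumes "2 \<le> M" "1 \<le> k" "k \<le> n"
    and test: "task_density (ts k)
         + (\<Sum>i\<in>{1..<k}. (C i - C i * U i) / rel_deadline (ts k) + U i)
         \<le> real M - (real M - 1) * U_delta_max ts k"
  shows "c k j \<le> service M a \<sigma> k j (a k j + rel_deadline (ts k))"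
proof (rule ccontr)
  define D d \<delta> \<rho> where "D = rel_deadline (ts k)" and "d = a k j + D"
    and "\<delta> = task_density (ts k)"
    and "\<rho> = real M - (real M - 1) * U_delta_max ts k - \<delta>"
  assume "\<not> c k j \<le> service M a \<sigma> k j (a k j + rel_deadline (ts k))"
  then have miss: "service M a \<sigma> k j d < c k j" by (simp add: d_def D_def)
  have k: "k \<in> {1..n}" using assms by simp
  note tb = task_bounds[OF k]
  have D: "0 < D" using tasks[OF k] by (simp add: sporadic_task_def D_def)
  have \<delta>: "\<delta> = C k / min D (T k)" by (simp add: \<delta>_def task_density_def D_def)
  have \<delta>0: "0 \<le> \<delta>" using \<delta> tb D by simp
  have Umax: "\<delta> \<le> U_delta_max ts k" "\<And>i. i \<in> {1..<k} \<Longrightarrow> U i \<le> U_delta_max ts k"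
    unfolding U_delta_max_def \<delta>_def by (auto intro!: Max_ge simp del: Max_insert)
  \<comment> \<open>Replacing the maximum by \<open>\<delta>\<close> gives
    \<open>M - (M - 1) * \<delta> - \<delta>\<close>, which is
    \<open>M * (1 - \<delta>)\<close>.\<close>
  have \<rho>\<delta>: "\<rho> \<le> real M * (1 - \<delta>)"
  proof -
    have "(real M - 1) * \<delta> \<le> (real M - 1) * U_delta_max ts k"
      using \<open>2 \<le> M\<close> Umax(1) by (intro mult_left_mono) auto
    then show ?thesis by (simp add: \<rho>_def algebra_simps)
  qed
  have \<rho>U: "\<rho> \<le> real M - (real M - 1) * U i" if "i \<in> {1..<k}" for i
  proof -
    have "(real M - 1) * U i \<le> (real M - 1) * U_delta_max ts k"
      using \<open>2 \<le> M\<close> Umax(2)[OF that] by (intro mult_left_mono) auto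
    then show ?thesis using \<delta>0 by (simp add: \<rho>_def)
  qed

  have pend: "pending M a c \<sigma> k j d" using miss D by (simp add: pending_def d_def)
  then have "active k d" by (auto simp: active_def)
  then obtain p where p: "a k p \<le> d" "\<And>u. \<lbrakk>a k p \<le> u; u \<le> d\<rbrakk> \<Longrightarrow> active k u"
    "\<And>j'. j' < p \<Longrightarrow> \<not> pending M a c \<sigma> k j' (a k p)" and "p \<le> j"
    using busy_start[OF _ k] pend by metis
  define s where "s = a k p"
  have len: "D + real (j - p) * T k \<le> d - s"
    using arrival_spacing[OF k, of p "j - p"] \<open>p \<le> j\<close> by (simp add: d_def s_def)
  have "0 \<le> real (j - p) * T k" using tb by simp
  then have Ds: "D \<le> d - s" using len by linarith

  have "occupancy (runs k) s d < real (Suc j - p) * C k"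
    unfolding s_def by (rule late_task_work_lt[OF k \<open>p \<le> j\<close> pend p(3)])
  \<comment> \<open>Each job is charged \<open>C k = \<delta> * min D (T k)\<close>. Of the
    \<open>j - p + 1\<close> jobs, one is then fitted into the deadline \<open>D\<close> and the
    others into the \<open>j - p\<close> separations.\<close>
  also have "\<dots> = \<delta> * (real (Suc j - p) * min D (T k))"
    using \<delta> D tb by simp
  also have "\<dots> \<le> \<delta> * (d - s)"
  proof (rule mult_left_mono[OF _ \<delta>0])
    have "real (Suc j - p) * min D (T k) = min D (T k) + real (j - p) * min D (T k)"
      using \<open>p \<le> j\<close> by (simp add: Suc_diff_le algebra_simps)
    also have "\<dots> \<le> D + real (j - p) * T k"
      by (intro add_mono mult_left_mono) auto
    finally show "real (Suc j - p) * min D (T k) \<le> d - s" using len by simp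
  qed
  finally have "real M * ((d - s) - \<delta> * (d - s)) < real M * (d - s - occupancy (runs k) s d)"
    using \<open>2 \<le> M\<close> by simp
  also have "\<dots> \<le> work_above k s d"
    unfolding work_above_def s_def by (rule blocking_work[OF k p(1,2)])
  finally have "real M * (1 - \<delta>) * (d - s) < work_above k s d" by (simp add: algebra_simps)
  moreover have "\<rho> * (d - s) \<le> real M * (1 - \<delta>) * (d - s)"
    using \<rho>\<delta> Ds D by (intro mult_right_mono) auto
  ultimately have start: "0 < work_above k s d - \<rho> * (d - s)" by simp

  define f where "f t = work_above k t d - \<rho> * (d - t)" for t
  \<comment> \<open>The maximum is taken over a compact interval. A busy interval of task
    \<open>i\<close> starts at one of its arrivals, so reaching back to all first arrivals is far
    enough for the lightness condition.\<close>
  define b where "b = Min (insert s ((\<lambda>i. a i 0) ` {1..<k}))"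
  have b: "b \<le> s" "\<And>i. i \<in> {1..<k} \<Longrightarrow> b \<le> a i 0"
    unfolding b_def by (auto intro!: Min_le simp del: Min_insert)
  have "continuous_on {b..s} f"
    unfolding f_def work_above_def
    by (intro continuous_intros continuous_on_subset[OF continuous_on_occupancy_left[OF runs_borel]])
      (use Ds D in auto)
  then obtain r where r: "b \<le> r" "r \<le> s" "\<And>t. \<lbrakk>b \<le> t; t \<le> s\<rbrakk> \<Longrightarrow> f t \<le> f r"
    using continuous_attains_sup[of "{b..s}" f] b(1) by auto
  have rd: "r \<le> d" "D \<le> d - r" using r(2) Ds D by auto
  have "0 < f r" using start r(3)[of s] b(1) by (simp add: f_def)
  then have "\<rho> * (d - r) < work_above k r d" by (simp add: f_def)
  also have "\<dots> \<le> (\<Sum>i\<in>{1..<k}. U i * (d - r) + (C i - C i * U i))"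
    unfolding work_above_def
  proof (rule sum_mono)
    fix i assume i: "i \<in> {1..<k}"
    \<comment> \<open>This is \<open>f t \<le> f r\<close> after splitting the work in
      \<open>[t, d)\<close> at \<open>r\<close>.\<close>
    have "work_above k t r \<le> \<rho> * (r - t)" if "a i 0 \<le> t" "t \<le> r" for t
      using r(2) r(3)[of t] b(2)[OF i] that work_above_split[of t r d k] rd(1)
      by (simp add: f_def algebra_simps)
    then show "occupancy (runs i) r d \<le> U i * (d - r) + (C i - C i * U i)"
      by (rule compensated_work_le[OF i \<open>k \<le> n\<close> \<open>2 \<le> M\<close> rd(1) \<rho>U[OF i]])
  qed
  also have "\<dots> \<le> (\<Sum>i\<in>{1..<k}. ((C i - C i * U i) / D + U i) * (d - r))"
  proof (rule sum_mono)
    fix i assume "i \<in> {1..<k}"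
    then have "0 \<le> C i - C i * U i" using task_bounds[of i] \<open>k \<le> n\<close> by (simp add: mult_left_le)
    \<comment> \<open>The window has length at least \<open>D\<close>, so the constant term is
      covered by a rate of \<open>(C i - C i * U i) / D\<close> over the window.\<close>
    then have "(C i - C i * U i) / D * D \<le> (C i - C i * U i) / D * (d - r)"
      using D rd(2) by (intro mult_left_mono) auto
    then show "U i * (d - r) + (C i - C i * U i) \<le> ((C i - C i * U i) / D + U i) * (d - r)"
      using D by (simp add: distrib_right)
  qed
  also have "\<dots> = (\<Sum>i\<in>{1..<k}. (C i - C i * U i) / D + U i) * (d - r)"
    by (rule sum_distrib_right[symmetric])
  also have "\<dots> \<le> \<rho> * (d - r)"
    using test rd(1) by (intro mult_right_mono) (auto simp: \<rho>_def \<delta>_def D_def)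
  finally show False by simp
qed

end

theorem theorem4p7:
  fixes M n k :: nat and ts :: "nat \<Rightarrow> task"
  assumes "2 \<le> M"
    and "1 \<le> k" and "k \<le> n"
    and "\<forall>i\<in>{1..n}. sporadic_task (ts i)"
    and "\<forall>i\<in>{1..<k}. schedulable M n ts i"
    and "task_density (ts k)
         + (\<Sum>i\<in>{1..<k}. (wcet (ts i) - wcet (ts i) * utilization (ts i)) / rel_deadline (ts k)
                         + utilization (ts i))
         \<le> real M - (real M - 1) * U_delta_max ts k"
  shows "schedulable M n ts k"
  unfolding schedulable_def
proof (intro allI impI)
  fix a c \<sigma> j
  assume "legal_jobs n ts a c" "gfp_schedule M n a c \<sigma>"
  then interpret gfp_run M n ts a c \<sigma>
    using assms(4) by unfold_locales auto
  show "c k j \<le> service M a \<sigma> k j (a k j + rel_deadline (ts k))"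
    by (rule no_deadline_miss[OF assms(1,2,3,6)])
qed

end
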